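(* Let $n\ge1$ and let $\sigma$ be a permutation of $\{1,\dots,n\}$. For every position $w\in\mathcal{W}$ of Partizan-Serial-Nim, the atomic weight of $w$ is an integer: $\mathrm{aw}(w)\in\mathbb{Z}$.
   Context: Partizan-Serial-Nim: fix an integer $n\ge1$ and a permutation $\sigma$ of $[n]=\{1,\dots,n\}$. Positions are the elements of $\mathcal{W}=\{(w_1,\dots,w_n): w_i\in\mathbb{Z}_{\ge0}\}$; $\mathbf{0}=(0,\dots,0)$ is the only terminal position. For $w\neq\mathbf{0}$, Left's target pile is $l(w)=\min\{i: w_i>0\}$ and Right's target pile $r(w)$ is the index $i$ with $w_i>0$ minimizing $\sigma(i)$. A Left (resp. Right) move from $w$ replaces the entry $w_{l(w)}$ (resp. $w_{r(w)}$) by any strictly smaller non-negative integer. Each position is regarded as a short combinatorial game under normal play; it is dicotic (in every subposition either both players have a move or neither does). Atomic weight: for a dicotic game $G$, the atomic weight $\mathrm{aw}(G)$ is the game (up to equality of game values) characterized recursively as follows. Let $\tilde v(G)=\{\mathrm{aw}(G^L)-2\mid \mathrm{aw}(G^R)+2\}$, where $G^L$, $G^R$ range over all Left, respectively Right, options of $G$. If $\tilde v(G)$ is not equal to an integer, then $\mathrm{aw}(G)=\tilde v(G)$. If $\tilde v(G)$ is equal to an integer, let $\mathcal{I}$ be the set of integers $k$ such that $\mathrm{aw}(G^L)-2\not\ge k$ and $k\not\ge \mathrm{aw}(G^R)+2$ for all $G^L,G^R$; then $\mathrm{aw}(G)$ is the smallest element of $\mathcal{I}$ if $G<\bigstar$,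 the largest element of $\mathcal{I}$ if $G>\bigstar$, and $0$ if $G$ is incomparable with (confused with) $\bigstar$. Here $\bigstar$ (the far star) denotes a nimber $\ast m$ with $m$ sufficiently large, so that $\ast m$ is not a subposition of $G$. "$\mathrm{aw}(G)\in\mathbb{Z}$" means that $\mathrm{aw}(G)$ equals an integer as a game value. *)

theory Defs
  imports Complex_Main "HOL-Library.FSet" "HOL-Combinatorics.Permutations"
begin

section \<open>Short partizan games\<close>

datatype game = Game (left_opts: "game fset") (right_opts: "game fset")

lemma size_left_option: "H |\<in>| left_opts G \<Longrightarrow> size H < size G"
  using member_le_sum[of H "fset (left_opts G)" "\<lambda>x. Suc (size x)"] by (cases G) auto

lemma size_right_option: "H |\<in>| right_opts G \<Longrightarrow> size H < size G"
  using member_le_sum[of H "fset (right_opts G)" "\<lambda>x. Suc (size x)"] by (cases G) auto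

lemmas size_option = size_left_option size_right_option

function game_le :: "game \<Rightarrow> game \<Rightarrow> bool" where
  "game_le G H \<longleftrightarrow>
     (\<forall>GL |\<in>| left_opts G. \<not> game_le H GL) \<and>
     (\<forall>HR |\<in>| right_opts H. \<not> game_le HR G)"
  by auto
termination
  by (relation "measure (\<lambda>(G, H). size G + size H)") (auto dest: size_option)

declare game_le.simps [simp del]

lemma game_le_refl: "game_le G G"
proof (induction "size G" arbitrary: G rule: less_induct)
  case less
  then have "\<not> game_le G H" if "H |\<in>| left_opts G" for H
    using that size_left_option game_le.simps[of G H] by blast
  moreover have "\<not> game_le H G" if "H |\<in>| right_opts G" for H
    using that less size_right_option game_le.simps[of H G] by blast
  ultimately show ?case using game_le.simps[of G G] by blast
qed

lemma game_le_trans: "game_le G H \<Longrightarrow> game_le H K \<Longrightarrow> game_le G K"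
proof (induction "size G + size H + size K" arbitrary: G H K rule: less_induct)
  case less
  have "\<not> game_le K GL" if GL: "GL |\<in>| left_opts G" for GL
  proof
    assume "game_le K GL"
    with less.hyps[of H K GL] less.prems size_left_option[OF GL] have "game_le H GL"
      by simp
    with GL less.prems(1) show False using game_le.simps[of G H] by blast
  qed
  moreover have "\<not> game_le KR G" if KR: "KR |\<in>| right_opts K" for KR
  proof
    assume "game_le KR G"
    with less.hyps[of KR G H] less.prems size_right_option[OF KR] have "game_le KR H"
      by simp
    with KR less.prems(2) show False using game_le.simps[of H K] by blast
  qed
  ultimately show ?case using game_le.simps[of G K] by blast
qed

instantiation game :: preorder
begin

definition "G \<le> H \<longleftrightarrow> game_le G H" for G H :: game
definition "G < H \<longleftrightarrow> G \<le> H \<and> \<not> H \<le> G" for G H :: game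

instance
  by standard (auto simp: less_eq_game_def less_game_def intro: game_le_refl game_le_trans)

end

lemma game_le_iff:
  "G \<le> H \<longleftrightarrow> (\<forall>GL |\<in>| left_opts G. \<not> H \<le> GL) \<and> (\<forall>HR |\<in>| right_opts H. \<not> HR \<le> G)"
  for G H :: game
  unfolding less_eq_game_def by (rule game_le.simps)

text \<open>Equality of game values; HOL equality on \<^typ>\<open>game\<close> is identity of game trees.\<close>

definition game_eq :: "game \<Rightarrow> game \<Rightarrow> bool" (infix "\<doteq>" 50) where
  "G \<doteq> H \<longleftrightarrow> G \<le> H \<and> H \<le> G"

declare fimage_cong [fundef_cong]

function game_add :: "game \<Rightarrow> game \<Rightarrow> game" where
  "game_add G H = Game
     ((\<lambda>GL. game_add GL H) |`| left_opts G |\<union>| (\<lambda>HL. game_add G HL) |`| left_opts H)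
     ((\<lambda>GR. game_add GR H) |`| right_opts G |\<union>| (\<lambda>HR. game_add G HR) |`| right_opts H)"
  by auto
termination
  by (relation "measure (\<lambda>(G, H). size G + size H)") (auto dest: size_option)

declare game_add.simps [simp del]

primrec game_neg :: "game \<Rightarrow> game" where
  "game_neg (Game L R) = Game (game_neg |`| R) (game_neg |`| L)"

instantiation game :: "{zero, plus, uminus, minus}"
begin

definition "0 = Game {||} {||}"
definition "G + H = game_add G H" for G H :: game
definition "- G = game_neg G" for G :: game
definition "G - H = G + - H" for G H :: game

instance ..

end

fun nat_game :: "nat \<Rightarrow> game" where
  "nat_game 0 = 0"
| "nat_game (Suc k) = Game {|nat_game k|} {||}"

definition int_game :: "int \<Rightarrow> game" where
  "int_game k = (if 0 \<le> k then nat_game (nat k) else - nat_game (nat (- k)))"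

definition is_integer :: "game \<Rightarrow> bool" where
  "is_integer G \<longleftrightarrow> (\<exists>k. G \<doteq> int_game k)"

function nimber :: "nat \<Rightarrow> game" where
  "nimber m = Game (nimber |`| fset_of_list [0..<m]) (nimber |`| fset_of_list [0..<m])"
  by auto
termination
  by (relation "measure id") (auto simp: fset_of_list_elem)

declare nimber.simps [simp del]

inductive_set subpositions :: "game \<Rightarrow> game set" for G :: game where
  self: "G \<in> subpositions G"
| left: "H \<in> subpositions G \<Longrightarrow> HL |\<in>| left_opts H \<Longrightarrow> HL \<in> subpositions G"
| right: "H \<in> subpositions G \<Longrightarrow> HR |\<in>| right_opts H \<Longrightarrow> HR \<in> subpositions G"

definition dicotic :: "game \<Rightarrow> bool" where
  "dicotic G \<longleftrightarrow> (\<forall>H \<in> subpositions G. left_opts H = {||} \<longleftrightarrow> right_opts H = {||})"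


section \<open>Atomic weight\<close>

text \<open>
  The nimber chosen for the far star is the first one from which on no nimber is equal in
  value to a subposition of \<^term>\<open>G\<close>. (A short game has finitely many subpositions and distinct
  nimbers have distinct values, so there is one.)
\<close>

definition far_star :: "game \<Rightarrow> game" where
  "far_star G = nimber (LEAST m. \<forall>k\<ge>m. \<forall>H \<in> subpositions G. \<not> H \<doteq> nimber k)"

text \<open>
  \<open>aw\<close> is meant for dicotic games. Atomic weight is only determined up to \<open>\<doteq>\<close>; in the integer
  case \<open>aw\<close> returns the standard form of the integer, otherwise the form \<open>v\<close> itself.
  For a nonzero dicotic game the set \<open>I\<close> is bounded on both sides. For the zero game
  \<open>I = UNIV\<close>, but there the third case applies. The last \<open>else\<close> is precisely the confused case,
  since \<^term>\<open>G\<close> is never equal to \<^term>\<open>far_star G\<close>.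
\<close>

function aw :: "game \<Rightarrow> game" where
  "aw G =
    (let L = (\<lambda>GL. aw GL - int_game 2) |`| left_opts G;
         R = (\<lambda>GR. aw GR + int_game 2) |`| right_opts G;
         v = Game L R;
         I = {k. (\<forall>x |\<in>| L. \<not> int_game k \<le> x) \<and> (\<forall>y |\<in>| R. \<not> y \<le> int_game k)}
     in if \<not> is_integer v then v
        else if G < far_star G then int_game (LEAST k. k \<in> I)
        else if far_star G < G then int_game (GREATEST k. k \<in> I)
        else int_game 0)"
  by auto
termination
  by (relation "measure size") (auto dest: size_option)

declare aw.simps [simp del]


section \<open>Partizan-Serial-Nim\<close>

text \<open>
  Piles are numbered \<open>1, \<dots>, n\<close>; a position is a function from pile numbers to pile sizes
  that vanishes outside \<^term>\<open>{1..n}\<close>.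
\<close>

definition positions :: "nat \<Rightarrow> (nat \<Rightarrow> nat) set" where
  "positions n = {w. \<forall>i. i \<notin> {1..n} \<longrightarrow> w i = 0}"

definition left_target :: "nat \<Rightarrow> (nat \<Rightarrow> nat) \<Rightarrow> nat" where
  "left_target n w = (LEAST i. i \<in> {1..n} \<and> 0 < w i)"

definition right_target :: "nat \<Rightarrow> (nat \<Rightarrow> nat) \<Rightarrow> (nat \<Rightarrow> nat) \<Rightarrow> nat" where
  "right_target n \<sigma> w = (ARG_MIN \<sigma> i. i \<in> {1..n} \<and> 0 < w i)"

lemma left_target:
  assumes "i \<in> {1..n}" "0 < w i"
  shows "left_target n w \<in> {1..n}" "0 < w (left_target n w)"
  using LeastI[of "\<lambda>i. i \<in> {1..n} \<and> 0 < w i" i] assms by (auto simp: left_target_def)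

lemma right_target:
  assumes "i \<in> {1..n}" "0 < w i"
  shows "right_target n \<sigma> w \<in> {1..n}" "0 < w (right_target n \<sigma> w)"
  using arg_min_natI[of "\<lambda>i. i \<in> {1..n} \<and> 0 < w i" i \<sigma>] assms by (auto simp: right_target_def)

lemma sum_fun_upd_less:
  fixes w :: "nat \<Rightarrow> nat"
  assumes "i \<in> {1..n}" "k < w i"
  shows "(\<Sum>j=1..n. (w(i := k)) j) < (\<Sum>j=1..n. w j)"
  using assms by (intro sum_strict_mono_ex1) auto

function psn :: "nat \<Rightarrow> (nat \<Rightarrow> nat) \<Rightarrow> (nat \<Rightarrow> nat) \<Rightarrow> game" where
  "psn n \<sigma> w =
    (if \<forall>i \<in> {1..n}. w i = 0 then 0
     else let l = left_target n w; r = right_target n \<sigma> w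
       in Game ((\<lambda>k. psn n \<sigma> (w(l := k))) |`| fset_of_list [0..<w l])
               ((\<lambda>k. psn n \<sigma> (w(r := k))) |`| fset_of_list [0..<w r]))"
  by auto
termination
proof (relation "measure (\<lambda>(n, \<sigma>, w). \<Sum>j=1..n. w j)", goal_cases)
  case (2 n \<sigma> w l r k)
  then obtain i where "i \<in> {1..n}" "0 < w i" by auto
  from left_target(1)[of i n w, OF this] 2 sum_fun_upd_less[of "left_target n w" n k w] show ?case
    by (simp add: fset_of_list_elem)
next
  case (3 n \<sigma> w l r k)
  then obtain i where "i \<in> {1..n}" "0 < w i" by auto
  from right_target(1)[of i n w, OF this, of \<sigma>] 3 sum_fun_upd_less[of "right_target n \<sigma> w" n k w] show ?case
    by (simp add: fset_of_list_elem)
qed simp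

declare psn.simps [simp del]

lemma dicotic_psn: "dicotic (psn n \<sigma> w)"
proof -
  have "\<exists>u. H = psn n \<sigma> u" if "H \<in> subpositions (psn n \<sigma> w)" for H
    using that
  proof induction
    case self
    show ?case by blast
  next
    case (left H HL)
    then obtain u where "HL |\<in>| left_opts (psn n \<sigma> u)" by blast
    then show ?case by (subst (asm) psn.simps) (auto simp: Let_def zero_game_def split: if_splits)
  next
    case (right H HR)
    then obtain u where "HR |\<in>| right_opts (psn n \<sigma> u)" by blast
    then show ?case by (subst (asm) psn.simps) (auto simp: Let_def zero_game_def split: if_splits)
  qed
  moreover have "left_opts (psn n \<sigma> u) = {||} \<longleftrightarrow> right_opts (psn n \<sigma> u) = {||}" for u
  proof (cases "\<forall>i \<in> {1..n}. u i = 0")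
    case True
    then show ?thesis by (subst (1 2) psn.simps) (simp add: zero_game_def)
  next
    case False
    then obtain i where "i \<in> {1..n}" "0 < u i" by auto
    moreover have "fset_of_list [0..<m] \<noteq> {||}" if "0 < m" for m :: nat
      using that fset_of_list_elem[of 0 "[0..<m]"] by auto
    ultimately show ?thesis
      using left_target(2)[of i n u] right_target(2)[of i n u \<sigma>] False
      by (subst (1 2) psn.simps) (auto simp: Let_def)
  qed
  ultimately show ?thesis by (auto simp: dicotic_def)
qed

end

theory Submission
  imports Defs
begin

text \<open>
  Suppose that all options of a dicotic game \<open>G\<close> have integer atomic weights. An integer \<open>k\<close> fits,
  that is, lies in the set \<open>I\<close> of the definition of \<^const>\<open>aw\<close>, exactly if the Left options have
  weight at most \<open>k + 1\<close> and the Right options at least \<open>k - 1\<close>. If some integer fits, then \<open>v\<close> is the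
  simplest fitting integer, so \<open>aw G\<close> is an integer. If \<open>G\<close> has options, this can fail only if some
  Left option exceeds some Right option by more than 2.

  In Partizan-Serial-Nim this does not happen, because the players do not disturb one another. If
  their target piles differ, then a Left move and a Right move commute, and the position \<open>K\<close> after
  both is a Right option of the Left option and a Left option of the Right option. If they share
  the target pile, then the position \<open>K\<close> without that pile can still be reached by either player
  from every option except \<open>K\<close> itself. Call a game with such a common \<open>K\<close> for each pair of options
  confluent (\<open>confluent_psn\<close>). If the weight of every option fits that option, then the weight of
  the Left option is at most one more, and that of the Right option at least one less, than the
  weight of \<open>K\<close>, so the two differ by at most 2 in the dangerous direction.

  It remains to see that the weight of \<open>G\<close> itself fits \<open>G\<close>, so that the induction continues. The
  only doubtful case is weight 0 for \<open>G\<close> confused with the far star. It requires a link from the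
  weights of the options back to the order: weight \<open>\<ge> 1\<close> means being above the far star, and
  weight \<open>\<ge> 2\<close> implies being above all nimbers. This link is proved in the same
  induction (\<open>calibrated_step\<close>); \<open>confluent_aw_integer\<close> is the resulting statement about
  arbitrary confluent dicotic games.
\<close>


section \<open>Comparison with nimbers and the far star\<close>

lemma left_opts_nimber: "fset (left_opts (nimber m)) = nimber ` {..<m}"
  by (subst nimber.simps) (auto simp: fset_of_list.rep_eq)

lemma right_opts_nimber: "fset (right_opts (nimber m)) = nimber ` {..<m}"
  by (subst nimber.simps) (auto simp: fset_of_list.rep_eq)

lemma le_nimber_iff:
  "G \<le> nimber m \<longleftrightarrow> (\<forall>X |\<in>| left_opts G. \<not> nimber m \<le> X) \<and> (\<forall>j<m. \<not> nimber j \<le> G)"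
  by (subst game_le_iff) (auto simp: right_opts_nimber)

lemma nimber_le_iff:
  "nimber m \<le> G \<longleftrightarrow> (\<forall>j<m. \<not> G \<le> nimber j) \<and> (\<forall>Y |\<in>| right_opts G. \<not> Y \<le> nimber m)"
  by (subst game_le_iff) (auto simp: left_opts_nimber)

lemma nimber_le_nimber_iff: "nimber j \<le> nimber k \<longleftrightarrow> j = k"
proof
  assume le: "nimber j \<le> nimber k"
  then have "\<not> k < j" "\<not> j < k"
    using nimber_le_iff[of j "nimber k"] le_nimber_iff[of "nimber j" k] by auto
  then show "j = k" by simp
qed simp

lemma subpositions_trans:
  assumes "H \<in> subpositions G" "K \<in> subpositions H"
  shows "K \<in> subpositions G"
  using assms(2,1) by induction (auto intro: subpositions.intros)

lemma subpositions_option: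
  assumes "X |\<in>| left_opts G |\<union>| right_opts G" "H \<in> subpositions X"
  shows "H \<in> subpositions G"
proof (rule subpositions_trans[OF _ assms(2)])
  show "X \<in> subpositions G" using assms(1) by (auto intro: subpositions.intros)
qed

lemma finite_subpositions: "finite (subpositions G)"
proof (induction "size G" arbitrary: G rule: less_induct)
  case less
  let ?O = "left_opts G |\<union>| right_opts G"
  have "H \<in> insert G (\<Union>X\<in>fset ?O. subpositions X)" if "H \<in> subpositions G" for H
    using that by induction (auto intro: subpositions.intros)
  then have "subpositions G \<subseteq> insert G (\<Union>X\<in>fset ?O. subpositions X)" by blast
  moreover have "finite (insert G (\<Union>X\<in>fset ?O. subpositions X))"
    using less by (auto dest: size_option)
  ultimately show ?case by (rule finite_subset)
qed

text \<open>
  The least such \<open>m\<close> is the index of \<^const>\<open>far_star\<close>. The freedom in \<open>m\<close> lets one nimber serve a game and all its options at once.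
\<close>

definition remote :: "nat \<Rightarrow> game \<Rightarrow> bool" where
  "remote m G \<longleftrightarrow> (\<forall>k\<ge>m. \<forall>H \<in> subpositions G. \<not> H \<doteq> nimber k)"

lemma remote_option: "remote m G \<Longrightarrow> X |\<in>| left_opts G |\<union>| right_opts G \<Longrightarrow> remote m X"
  unfolding remote_def using subpositions_option by blast

lemma remote_mono: "remote m G \<Longrightarrow> m \<le> k \<Longrightarrow> remote k G"
  by (auto simp: remote_def)

text \<open>
  Distinct nimbers are incomparable, so each of the finitely many subpositions excludes at most
  one nimber.
\<close>

lemma ex_remote: "\<exists>m. remote m G"
proof -
  have "finite {k. H \<doteq> nimber k}" for H
  proof (rule finite_subset)
    show "{k. H \<doteq> nimber k} \<subseteq> {SOME k. H \<doteq> nimber k}"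
      by (auto simp: game_eq_def) (metis (mono_tags, lifting) nimber_le_nimber_iff order_trans someI)
  qed simp
  then have "finite (\<Union>H\<in>subpositions G. {k. H \<doteq> nimber k})"
    using finite_subpositions by blast
  then obtain m where "\<forall>k\<in>(\<Union>H\<in>subpositions G. {k. H \<doteq> nimber k}). k < m"
    using finite_nat_set_iff_bounded by blast
  then have "remote m G" unfolding remote_def by (auto simp: not_less[symmetric])
  then show ?thesis ..
qed

lemma far_star_remote: obtains m where "far_star G = nimber m" "remote m G"
proof
  show "far_star G = nimber (LEAST m. remote m G)"
    by (simp add: far_star_def remote_def)
  show "remote (LEAST m. remote m G) G"
    using LeastI_ex[OF ex_remote] .
qed

text \<open>
  The options of \<open>G\<close> are covered by induction, so only the additional moves inside the larger nimber
  could make a difference. They do not, because \<open>*j \<le> G \<le> *k\<close> is impossible for \<open>j \<ge> m\<close>: it would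
  make \<open>*j\<close> and \<open>*k\<close> comparable, hence \<open>j = k\<close>, and \<open>G\<close> equal to \<open>*j\<close>, which \<open>m\<close> rules out.
\<close>

lemma remote_le_cong:
  assumes "remote m G" "m \<le> j" "m \<le> k"
  shows "nimber j \<le> G \<longleftrightarrow> nimber k \<le> G" "G \<le> nimber j \<longleftrightarrow> G \<le> nimber k"
proof -
  have "(nimber j \<le> G \<longrightarrow> nimber k \<le> G) \<and> (G \<le> nimber j \<longrightarrow> G \<le> nimber k)"
    if "remote m G" "m \<le> j" "m \<le> k" for j k
    using that
  proof (induction "size G" arbitrary: G j k rule: less_induct)
    case less
    have sep: "\<not> (nimber i \<le> G \<and> G \<le> nimber i')" if "m \<le> i" for i i'
    proof
      assume le: "nimber i \<le> G \<and> G \<le> nimber i'"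
      then have "i = i'" using nimber_le_nimber_iff order_trans by blast
      with le have "G \<doteq> nimber i" by (simp add: game_eq_def)
      with less.prems(1) that show False unfolding remote_def by (blast intro: subpositions.self)
    qed
    have L: "X \<le> nimber j \<longleftrightarrow> X \<le> nimber k" "nimber j \<le> X \<longleftrightarrow> nimber k \<le> X"
      if "X |\<in>| left_opts G |\<union>| right_opts G" for X
      using less.hyps[of X j k] less.hyps[of X k j] less.prems remote_option[OF less.prems(1) that]
        that size_option by blast+
    have "nimber k \<le> G" if "nimber j \<le> G"
    proof (subst nimber_le_iff, intro conjI ballI allI impI)
      show "\<not> Y \<le> nimber k" if "Y |\<in>| right_opts G" for Y
        using that \<open>nimber j \<le> G\<close> L(1)[of Y] nimber_le_iff[of j G] by auto
      show "\<not> G \<le> nimber i" if "i < k" for i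
        using \<open>nimber j \<le> G\<close> sep[of j i] less.prems by auto
    qed
    moreover have "G \<le> nimber k" if "G \<le> nimber j"
    proof (subst le_nimber_iff, intro conjI ballI allI impI)
      show "\<not> nimber k \<le> X" if "X |\<in>| left_opts G" for X
        using that \<open>G \<le> nimber j\<close> L(2)[of X] le_nimber_iff[of G j] by auto
      show "\<not> nimber i \<le> G" if "i < k" for i
      proof (cases "i < j")
        case True
        then show ?thesis using \<open>G \<le> nimber j\<close> le_nimber_iff[of G j] by auto
      next
        case False
        then show ?thesis using \<open>G \<le> nimber j\<close> sep[of i j] less.prems by auto
      qed
    qed
    ultimately show ?case by blast
  qed
  from this[OF assms] this[OF assms(1,3,2)]
  show "nimber j \<le> G \<longleftrightarrow> nimber k \<le> G" "G \<le> nimber j \<longleftrightarrow> G \<le> nimber k" by blast+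
qed

lemma far_star_le_iff:
  assumes "remote m G"
  shows "far_star G \<le> G \<longleftrightarrow> nimber m \<le> G" "G \<le> far_star G \<longleftrightarrow> G \<le> nimber m"
proof -
  obtain k where k: "far_star G = nimber k" "remote k G" by (rule far_star_remote)
  let ?i = "max k m"
  have "nimber k \<le> G \<longleftrightarrow> nimber ?i \<le> G" "G \<le> nimber k \<longleftrightarrow> G \<le> nimber ?i"
    using remote_le_cong[OF k(2), of k ?i] by auto
  moreover have "nimber m \<le> G \<longleftrightarrow> nimber ?i \<le> G" "G \<le> nimber m \<longleftrightarrow> G \<le> nimber ?i"
    using remote_le_cong[OF assms, of m ?i] by auto
  ultimately show "far_star G \<le> G \<longleftrightarrow> nimber m \<le> G" "G \<le> far_star G \<longleftrightarrow> G \<le> nimber m"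
    using k(1) by auto
qed

lemma not_far_star_eq: "\<not> (far_star G \<le> G \<and> G \<le> far_star G)"
proof -
  obtain k where "far_star G = nimber k" "remote k G" by (rule far_star_remote)
  then show ?thesis unfolding remote_def game_eq_def by (metis order_refl subpositions.self)
qed

text \<open>
  If \<open>*i \<le> G\<close> for a remote \<open>i > k\<close>, then Right may not profit from moving \<open>*i\<close> to \<open>*k\<close> in \<open>G + *i\<close>,
  so \<open>G \<le> *k\<close> fails. Thus a game above the far star is below no nimber, small ones included.
\<close>

lemma far_star_le_not_le_nimber:
  assumes "far_star G \<le> G"
  shows "\<not> G \<le> nimber k"
proof -
  obtain m where m: "far_star G = nimber m" "remote m G" by (rule far_star_remote)
  let ?i = "max (Suc k) m"
  have "nimber ?i \<le> G" using assms far_star_le_iff(1) remote_mono[OF m(2), of ?i] by simp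
  then show ?thesis using nimber_le_iff[of ?i G] by simp
qed

lemma le_far_star_not_nimber_le:
  assumes "G \<le> far_star G"
  shows "\<not> nimber k \<le> G"
proof -
  obtain m where m: "far_star G = nimber m" "remote m G" by (rule far_star_remote)
  let ?i = "max (Suc k) m"
  have "G \<le> nimber ?i" using assms far_star_le_iff(2) remote_mono[OF m(2), of ?i] by simp
  then show ?thesis using le_nimber_iff[of G ?i] by simp
qed


section \<open>Integers as games\<close>

lemma left_opts_int_game: "left_opts (int_game k) = (if 0 < k then {|int_game (k - 1)|} else {||})"
proof (cases "0 < k")
  case True
  then have "nat k = Suc (nat (k - 1))" by simp
  with True show ?thesis by (simp add: int_game_def)
next
  case False
  show ?thesis
  proof (cases "k = 0")
    case True
    then show ?thesis by (simp add: int_game_def zero_game_def)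
  next
    case k: False
    with False have "nat (- k) = Suc (nat (- k - 1))" by simp
    with False k show ?thesis by (simp add: int_game_def uminus_game_def)
  qed
qed

lemma right_opts_int_game: "right_opts (int_game k) = (if k < 0 then {|int_game (k + 1)|} else {||})"
proof (cases "k < 0")
  case True
  then have "nat (- k) = Suc (nat (- k - 1))" by simp
  with True show ?thesis
    by (cases "k + 1 = 0") (simp_all add: int_game_def uminus_game_def zero_game_def ac_simps minus_diff_commute)
next
  case False
  then show ?thesis by (cases "nat k") (simp_all add: int_game_def zero_game_def)
qed

lemma int_game_le_iff: "int_game j \<le> int_game k \<longleftrightarrow> j \<le> k"
proof (induction "nat \<bar>j\<bar> + nat \<bar>k\<bar>" arbitrary: j k rule: less_induct)
  case less
  have "int_game k \<le> int_game (j - 1) \<longleftrightarrow> k \<le> j - 1" if "0 < j"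
    using that by (intro less) auto
  moreover have "int_game (k + 1) \<le> int_game j \<longleftrightarrow> k + 1 \<le> j" if "k < 0"
    using that by (intro less) auto
  ultimately show ?case
    by (subst game_le_iff) (auto simp: left_opts_int_game right_opts_int_game)
qed

lemma int_game_inject: "int_game j = int_game k \<longleftrightarrow> j = k"
  by (metis int_game_le_iff order_antisym order_refl)

lemma left_opts_add:
  "left_opts (G + H) = (\<lambda>X. X + H) |`| left_opts G |\<union>| (\<lambda>X. G + X) |`| left_opts H"
  unfolding plus_game_def by (subst game_add.simps) simp

lemma right_opts_add:
  "right_opts (G + H) = (\<lambda>X. X + H) |`| right_opts G |\<union>| (\<lambda>X. G + X) |`| right_opts H"
  unfolding plus_game_def by (subst game_add.simps) simp

text \<open>
  The sum of two integers is a different tree from the integer that it represents. Both comparisons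
  are needed together, as each move reverses the inequality.
\<close>

lemma int_game_add_le_iff:
  "int_game c \<le> int_game a + int_game b \<longleftrightarrow> c \<le> a + b"
  "int_game a + int_game b \<le> int_game c \<longleftrightarrow> a + b \<le> c"
proof (induction "nat \<bar>a\<bar> + nat \<bar>b\<bar> + nat \<bar>c\<bar>" arbitrary: a b c rule: less_induct)
  case less
  {
    case 1
    have "int_game a + int_game b \<le> int_game (c - 1) \<longleftrightarrow> a + b \<le> c - 1" if "0 < c"
      using that by (intro less) auto
    moreover have "int_game (a + 1) + int_game b \<le> int_game c \<longleftrightarrow> (a + 1) + b \<le> c" if "a < 0"
      using that by (intro less) auto
    moreover have "int_game a + int_game (b + 1) \<le> int_game c \<longleftrightarrow> a + (b + 1) \<le> c" if "b < 0"
      using that by (intro less) auto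
    ultimately show ?case
      by (subst game_le_iff) (auto simp: left_opts_int_game right_opts_int_game right_opts_add)
  next
    case 2
    have "int_game (c + 1) \<le> int_game a + int_game b \<longleftrightarrow> c + 1 \<le> a + b" if "c < 0"
      using that by (intro less) auto
    moreover have "int_game c \<le> int_game (a - 1) + int_game b \<longleftrightarrow> c \<le> (a - 1) + b" if "0 < a"
      using that by (intro less) auto
    moreover have "int_game c \<le> int_game a + int_game (b - 1) \<longleftrightarrow> c \<le> a + (b - 1)" if "0 < b"
      using that by (intro less) auto
    ultimately show ?case
      by (subst game_le_iff) (auto simp: left_opts_int_game right_opts_int_game left_opts_add)
  }
qed

lemma le_int_game_minus_2: "int_game k \<le> int_game a - int_game 2 \<longleftrightarrow> k \<le> a - 2"
proof -
  have "- int_game 2 = int_game (- 2)" by (simp add: int_game_def)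
  then show ?thesis using int_game_add_le_iff(1)[of k a "- 2"] by (simp add: minus_game_def)
qed

text \<open>
  The value is the fitting integer \<open>i\<close> of least absolute value. The only option of \<open>i\<close>, if any, is an
  integer closer to 0, which does not fit; since it moves away from one side of the form, it must
  violate the other side, which is what the comparison of \<open>i\<close> with the form asks for.
\<close>

lemma is_integer_if_fits:
  assumes "\<forall>x |\<in>| L. \<not> int_game k \<le> x" "\<forall>y |\<in>| R. \<not> y \<le> int_game k"
  shows "is_integer (Game L R)"
proof -
  let ?fits = "\<lambda>i. (\<forall>x |\<in>| L. \<not> int_game i \<le> x) \<and> (\<forall>y |\<in>| R. \<not> y \<le> int_game i)"
  obtain i where i: "?fits i" and least: "\<And>j. ?fits j \<Longrightarrow> nat \<bar>i\<bar> \<le> nat \<bar>j\<bar>"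
    using ex_has_least_nat[of ?fits k "\<lambda>i. nat \<bar>i\<bar>"] assms(1,2) by blast
  have "\<not> int_game (i + 1) \<le> Game L R" if "i < 0"
  proof -
    have "\<not> ?fits (i + 1)"
    proof
      assume "?fits (i + 1)"
      from least[OF this] that show False by linarith
    qed
    moreover have "\<not> int_game (i + 1) \<le> x" if "x |\<in>| L" for x
    proof
      assume "int_game (i + 1) \<le> x"
      moreover have "int_game i \<le> int_game (i + 1)" by (simp add: int_game_le_iff)
      ultimately have "int_game i \<le> x" by (rule order_trans[rotated])
      with i that show False by blast
    qed
    ultimately obtain y where "y |\<in>| R" "y \<le> int_game (i + 1)" by blast
    then show ?thesis by (subst game_le_iff) auto
  qed
  moreover have "\<not> Game L R \<le> int_game (i - 1)" if "0 < i"
  proof -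
    have "\<not> ?fits (i - 1)"
    proof
      assume "?fits (i - 1)"
      from least[OF this] that show False by linarith
    qed
    moreover have "\<not> y \<le> int_game (i - 1)" if "y |\<in>| R" for y
    proof
      assume "y \<le> int_game (i - 1)"
      also have "int_game (i - 1) \<le> int_game i" by (simp add: int_game_le_iff)
      finally show False using i that by blast
    qed
    ultimately obtain x where "x |\<in>| L" "int_game (i - 1) \<le> x" by blast
    then show ?thesis by (subst game_le_iff) auto
  qed
  ultimately have "Game L R \<doteq> int_game i"
    unfolding game_eq_def using i
    by (subst (1 2) game_le_iff) (auto simp: left_opts_int_game right_opts_int_game)
  then show ?thesis unfolding is_integer_def ..
qed


section \<open>Confluent dicotic games\<close>

definition weight :: "game \<Rightarrow> int" where
  "weight G = (THE a. aw G = int_game a)"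

lemma weight_eq: "aw G = int_game a \<Longrightarrow> weight G = a"
  unfolding weight_def by (auto simp: int_game_inject)

text \<open>
  A diamond condition. The alternatives \<open>K = X\<close> and \<open>K = Y\<close> admit the case in which one player has
  already moved to the common position.
\<close>

definition confluent :: "game \<Rightarrow> bool" where
  "confluent G \<longleftrightarrow> (\<forall>X |\<in>| left_opts G. \<forall>Y |\<in>| right_opts G.
     \<exists>K. (K = X \<or> K |\<in>| right_opts X) \<and> (K = Y \<or> K |\<in>| left_opts Y))"

text \<open>
  The induction invariant, which ties an integer weight to the order. The clauses for \<open>\<plusminus>2\<close>
  are what allows a player who moves first to take an option of that weight and win against
  any nimber.
\<close>

definition calibrated :: "game \<Rightarrow> bool" where
  "calibrated G \<longleftrightarrow> aw G = int_game (weight G)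
     \<and> (far_star G \<le> G \<longleftrightarrow> 1 \<le> weight G) \<and> (G \<le> far_star G \<longleftrightarrow> weight G \<le> - 1)
     \<and> (2 \<le> weight G \<longrightarrow> (\<forall>k. nimber k \<le> G)) \<and> (weight G \<le> - 2 \<longrightarrow> (\<forall>k. G \<le> nimber k))"

text \<open>
  When the options have integer weights, this is membership in the set \<open>I\<close> of \<^const>\<open>aw\<close>: there,
  \<open>\<not> k \<le> weight X - 2\<close> is \<open>weight X \<le> k + 1\<close>, and dually for Right.
\<close>

definition weight_fits :: "game \<Rightarrow> int \<Rightarrow> bool" where
  "weight_fits G k \<longleftrightarrow>
     (\<forall>X |\<in>| left_opts G. weight X \<le> k + 1) \<and> (\<forall>Y |\<in>| right_opts G. k - 1 \<le> weight Y)"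

text \<open>The condition on pairs of options makes one less than the greatest Left weight fit.\<close>

lemma ex_weight_fits:
  assumes "left_opts G = {||} \<longleftrightarrow> right_opts G = {||}"
    and "\<And>X Y. X |\<in>| left_opts G \<Longrightarrow> Y |\<in>| right_opts G \<Longrightarrow> weight X \<le> weight Y + 2"
  shows "\<exists>k. weight_fits G k"
proof (cases "left_opts G = {||}")
  case True
  with assms(1) have "weight_fits G 0" unfolding weight_fits_def by simp
  then show ?thesis ..
next
  case False
  let ?M = "Max (weight ` fset (left_opts G))"
  have "?M \<in> weight ` fset (left_opts G)"
    using False by (intro Max_in) auto
  then obtain X where "X |\<in>| left_opts G" "weight X = ?M" by force
  then have "weight_fits G (?M - 1)"
    unfolding weight_fits_def using assms(2)[of X] by fastforce
  then show ?thesis ..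
qed

lemma Least_int:
  fixes P :: "int \<Rightarrow> bool"
  assumes "P k" and "\<And>i. P i \<Longrightarrow> b \<le> i"
  shows "P (LEAST i. P i)" "(LEAST i. P i) \<le> k"
proof -
  obtain x where x: "P x" "\<And>i. P i \<Longrightarrow> nat (x - b) \<le> nat (i - b)"
    using ex_has_least_nat[of P k "\<lambda>i. nat (i - b)"] assms(1) by blast
  then have "\<And>i. P i \<Longrightarrow> x \<le> i" using assms(2) by force
  with x(1) assms(1) show "P (LEAST i. P i)" "(LEAST i. P i) \<le> k"
    using Least_equality[of P x] by auto
qed

lemma Greatest_int:
  fixes P :: "int \<Rightarrow> bool"
  assumes "P k" and "\<And>i. P i \<Longrightarrow> i \<le> b"
  shows "P (GREATEST i. P i)" "k \<le> (GREATEST i. P i)"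
proof -
  obtain x where x: "P x" "\<And>i. P i \<Longrightarrow> nat (b - x) \<le> nat (b - i)"
    using ex_has_least_nat[of P k "\<lambda>i. nat (b - i)"] assms(1) by blast
  then have "\<And>i. P i \<Longrightarrow> i \<le> x" using assms(2) by force
  with x(1) assms(1) show "P (GREATEST i. P i)" "k \<le> (GREATEST i. P i)"
    using Greatest_equality[of P x] by auto
qed

lemma aw_eq_int_game:
  assumes "\<And>X. X |\<in>| left_opts G |\<union>| right_opts G \<Longrightarrow> aw X = int_game (weight X)"
    and "weight_fits G k"
  shows "aw G = int_game (if G < far_star G then LEAST i. weight_fits G i
     else if far_star G < G then GREATEST i. weight_fits G i else 0)"
proof -
  let ?L = "(\<lambda>X. aw X - int_game 2) |`| left_opts G"
  let ?R = "(\<lambda>Y. aw Y + int_game 2) |`| right_opts G"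
  have L: "int_game i \<le> aw X - int_game 2 \<longleftrightarrow> i \<le> weight X - 2" if "X |\<in>| left_opts G" for i X
    using that assms(1)[of X] by (simp add: le_int_game_minus_2)
  have R: "aw Y + int_game 2 \<le> int_game i \<longleftrightarrow> weight Y + 2 \<le> i" if "Y |\<in>| right_opts G" for i Y
    using that assms(1)[of Y] by (simp add: int_game_add_le_iff)
  have fits: "(\<forall>x |\<in>| ?L. \<not> int_game i \<le> x) \<and> (\<forall>y |\<in>| ?R. \<not> y \<le> int_game i) \<longleftrightarrow> weight_fits G i" for i
    unfolding weight_fits_def using L R by force
  have "is_integer (Game ?L ?R)"
    using assms(2) fits[of k] by (intro is_integer_if_fits[of _ k]) blast+
  then show ?thesis
    by (subst aw.simps) (simp only: Let_def mem_Collect_eq fits if_False not_True_eq_False simp_thms, simp)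
qed

text \<open>
  If \<open>G\<close> is above the far star, no Right option is below it, so all Right options have weight at least
  0; then a positive integer fits, and the greatest fitting integer is positive. This covers the
  two cases in which \<open>G\<close> is comparable with the far star. If \<open>G\<close> is confused with it, then
  0 fits: a Left option of weight at least 2 would beat every nimber, and as some integer fits,
  all Right options would have weight at least 0 and not be below the far star, so that \<open>G\<close> would
  be above it; dually for Right.
\<close>

lemma calibrated_step:
  assumes dic: "left_opts G = {||} \<longleftrightarrow> right_opts G = {||}"
    and cal: "\<And>X. X |\<in>| left_opts G |\<union>| right_opts G \<Longrightarrow> calibrated X"
    and fits: "weight_fits G k"
  shows "calibrated G" "weight_fits G (weight G)"
proof -
  obtain m where m: "remote m G" using ex_remote by blast
  have star: "far_star X \<le> X \<longleftrightarrow> nimber m \<le> X" "X \<le> far_star X \<longleftrightarrow> X \<le> nimber m"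
    if "X |\<in>| left_opts G |\<union>| right_opts G" for X
    using far_star_le_iff[OF remote_option[OF m that]] by blast+
  note starG = far_star_le_iff[OF m]
  \<comment> \<open>Left answers any move of Right to \<open>*j\<close> by moving to \<open>X\<close>.\<close>
  have above: "far_star G \<le> G" if "X |\<in>| left_opts G" "2 \<le> weight X" for X
  proof (unfold starG(1), subst nimber_le_iff, intro conjI ballI allI impI)
    show "\<not> G \<le> nimber j" if "j < m" for j
      using cal[of X] that \<open>X |\<in>| left_opts G\<close> \<open>2 \<le> weight X\<close> le_nimber_iff[of G j]
      unfolding calibrated_def by auto
    show "\<not> Y \<le> nimber m" if "Y |\<in>| right_opts G" for Y
      using cal[of Y] star(2)[of Y] fits \<open>X |\<in>| left_opts G\<close> \<open>2 \<le> weight X\<close> that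
      unfolding calibrated_def weight_fits_def by force
  qed
  have below: "G \<le> far_star G" if "Y |\<in>| right_opts G" "weight Y \<le> - 2" for Y
  proof (unfold starG(2), subst le_nimber_iff, intro conjI ballI allI impI)
    show "\<not> nimber j \<le> G" if "j < m" for j
      using cal[of Y] that \<open>Y |\<in>| right_opts G\<close> \<open>weight Y \<le> - 2\<close> nimber_le_iff[of j G]
      unfolding calibrated_def by auto
    show "\<not> nimber m \<le> X" if "X |\<in>| left_opts G" for X
      using cal[of X] star(1)[of X] fits \<open>Y |\<in>| right_opts G\<close> \<open>weight Y \<le> - 2\<close> that
      unfolding calibrated_def weight_fits_def by force
  qed
  have aw: "aw G = int_game (if G < far_star G then LEAST i. weight_fits G i
     else if far_star G < G then GREATEST i. weight_fits G i else 0)"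
    using aw_eq_int_game[OF _ fits] cal unfolding calibrated_def by blast
  consider (below) "G \<le> far_star G" "\<not> far_star G \<le> G" | (above) "far_star G \<le> G" "\<not> G \<le> far_star G"
    | (confused) "\<not> G \<le> far_star G" "\<not> far_star G \<le> G"
    using not_far_star_eq by blast
  then have "calibrated G \<and> weight_fits G (weight G)"
  proof cases
    case above
    have "\<not> G \<le> nimber 0" using far_star_le_not_le_nimber[OF above(1)] .
    then have "left_opts G \<noteq> {||}" using le_nimber_iff[of G 0] by auto
    with dic obtain Y where Y: "Y |\<in>| right_opts G" by auto
    have nonneg: "0 \<le> weight Y" if "Y |\<in>| right_opts G" for Y
      using above(1) starG(1) nimber_le_iff[of m G] star(2)[of Y] cal[of Y] that
      unfolding calibrated_def by force
    \<comment> \<open>If \<open>k \<le> 0\<close>, then the Left options have weight at most 1 and cannot prevent 1 from fitting.\<close>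
    have "weight_fits G (max k 1)"
      using fits nonneg unfolding weight_fits_def by force
    moreover have "i \<le> weight Y + 1" if "weight_fits G i" for i
      using that Y unfolding weight_fits_def by force
    ultimately have *: "weight_fits G (GREATEST i. weight_fits G i)" "1 \<le> (GREATEST i. weight_fits G i)"
      using Greatest_int[of "weight_fits G" "max k 1" "weight Y + 1"] by auto
    have w: "aw G = int_game (GREATEST i. weight_fits G i)"
      using aw above by (simp add: less_game_def)
    have "nimber j \<le> G" if "2 \<le> weight G" for j
    proof (subst nimber_le_iff, intro conjI ballI allI impI)
      show "\<not> G \<le> nimber i" for i using far_star_le_not_le_nimber[OF above(1)] .
      show "\<not> Y \<le> nimber j" if "Y |\<in>| right_opts G" for Y
        using cal[of Y] far_star_le_not_le_nimber[of Y j] * weight_eq[OF w] that \<open>2 \<le> weight G\<close>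
        unfolding calibrated_def weight_fits_def by force
    qed
    then show ?thesis
      using * w weight_eq[OF w] above unfolding calibrated_def by auto
  next
    case below
    have "\<not> nimber 0 \<le> G" using le_far_star_not_nimber_le[OF below(1)] .
    then have "right_opts G \<noteq> {||}" using nimber_le_iff[of 0 G] by auto
    with dic obtain X where X: "X |\<in>| left_opts G" by auto
    have nonpos: "weight X \<le> 0" if "X |\<in>| left_opts G" for X
      using below(1) starG(2) le_nimber_iff[of G m] star(1)[of X] cal[of X] that
      unfolding calibrated_def by force
    have "weight_fits G (min k (- 1))"
      using fits nonpos unfolding weight_fits_def by force
    moreover have "weight X - 1 \<le> i" if "weight_fits G i" for i
      using that X unfolding weight_fits_def by force
    ultimately have *: "weight_fits G (LEAST i. weight_fits G i)" "(LEAST i. weight_fits G i) \<le> - 1"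
      using Least_int[of "weight_fits G" "min k (- 1)" "weight X - 1"] by auto
    have w: "aw G = int_game (LEAST i. weight_fits G i)"
      using aw below by (simp add: less_game_def)
    have "G \<le> nimber j" if "weight G \<le> - 2" for j
    proof (subst le_nimber_iff, intro conjI ballI allI impI)
      show "\<not> nimber i \<le> G" for i using le_far_star_not_nimber_le[OF below(1)] .
      show "\<not> nimber j \<le> X" if "X |\<in>| left_opts G" for X
        using cal[of X] le_far_star_not_nimber_le[of X j] * weight_eq[OF w] that \<open>weight G \<le> - 2\<close>
        unfolding calibrated_def weight_fits_def by force
    qed
    then show ?thesis
      using * w weight_eq[OF w] below unfolding calibrated_def by auto
  next
    case confused
    have w: "aw G = int_game 0"
      using aw confused by (simp add: less_game_def)
    have "weight_fits G 0"
      using confused above below unfolding weight_fits_def by force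
    then show ?thesis
      using w weight_eq[OF w] confused unfolding calibrated_def by auto
  qed
  then show "calibrated G" "weight_fits G (weight G)" by blast+
qed

theorem confluent_aw_integer:
  assumes "dicotic G" "\<And>H. H \<in> subpositions G \<Longrightarrow> confluent H"
  shows "is_integer (aw G)"
proof -
  have "calibrated H \<and> weight_fits H (weight H)" if "H \<in> subpositions G" for H
    using that
  proof (induction "size H" arbitrary: H rule: less_induct)
    case less
    have opt: "calibrated X \<and> weight_fits X (weight X)"
      if "X |\<in>| left_opts H |\<union>| right_opts H" for X
      using that less by (auto intro: subpositions.intros size_option)
    have "weight X \<le> weight Y + 2" if XY: "X |\<in>| left_opts H" "Y |\<in>| right_opts H" for X Y
    proof -
      obtain K where K: "K = X \<or> K |\<in>| right_opts X" "K = Y \<or> K |\<in>| left_opts Y"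
        using assms(2)[OF less.prems] XY unfolding confluent_def by blast
      have "weight X - 1 \<le> weight K" "weight K \<le> weight Y + 1"
        using K opt[of X] opt[of Y] XY unfolding weight_fits_def by auto
      then show ?thesis by simp
    qed
    moreover have dic: "left_opts H = {||} \<longleftrightarrow> right_opts H = {||}"
      using assms(1) less.prems unfolding dicotic_def by blast
    ultimately obtain k where "weight_fits H k" using ex_weight_fits by blast
    with dic show ?case using calibrated_step[of H k] opt by blast
  qed
  then have "aw G = int_game (weight G)"
    unfolding calibrated_def by (blast intro: subpositions.self)
  then show ?thesis unfolding is_integer_def game_eq_def by auto
qed


section \<open>Confluence of Partizan-Serial-Nim\<close>

lemma left_opts_psn:
  "X |\<in>| left_opts (psn n \<sigma> w) \<longleftrightarrow> (\<exists>i\<in>{1..n}. 0 < w i) \<and>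
     (\<exists>k < w (left_target n w). X = psn n \<sigma> (w(left_target n w := k)))"
  by (subst psn.simps) (auto simp: Let_def zero_game_def fset_of_list_elem)

lemma right_opts_psn:
  "X |\<in>| right_opts (psn n \<sigma> w) \<longleftrightarrow> (\<exists>i\<in>{1..n}. 0 < w i) \<and>
     (\<exists>k < w (right_target n \<sigma> w). X = psn n \<sigma> (w(right_target n \<sigma> w := k)))"
  by (subst psn.simps) (auto simp: Let_def zero_game_def fset_of_list_elem)

lemma subpositions_psn: "H \<in> subpositions (psn n \<sigma> w) \<Longrightarrow> \<exists>u. H = psn n \<sigma> u"
  by (induction rule: subpositions.induct) (auto simp: left_opts_psn right_opts_psn)

text \<open>
  Emptying or reducing other piles, or reducing the target pile without emptying it, does not
  change the target.
\<close>

lemma left_target_unchanged: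
  assumes "l = left_target n w" "l \<in> {1..n}" "0 < u l" "\<And>i. 0 < u i \<Longrightarrow> 0 < w i"
  shows "left_target n u = l"
  unfolding left_target_def
proof (rule Least_equality)
  show "l \<le> i" if "i \<in> {1..n} \<and> 0 < u i" for i
    unfolding assms(1) left_target_def using that assms(4) by (intro Least_le) auto
qed (use assms in auto)

lemma right_target_unchanged:
  assumes "inj_on \<sigma> {1..n}"
    and "r = right_target n \<sigma> w" "r \<in> {1..n}" "0 < u r" "\<And>i. 0 < u i \<Longrightarrow> 0 < w i"
  shows "right_target n \<sigma> u = r"
proof -
  let ?r = "right_target n \<sigma> u"
  have u: "?r \<in> {1..n}" "0 < u ?r"
    using right_target[of r n u] assms by auto
  have "\<sigma> ?r \<le> \<sigma> r"
    unfolding right_target_def using assms by (intro arg_min_nat_le) auto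
  moreover have "\<sigma> r \<le> \<sigma> ?r"
    unfolding assms(2) right_target_def[of n \<sigma> w] using assms(5)[of ?r] u by (intro arg_min_nat_le) auto
  ultimately show ?thesis
    using inj_onD[OF assms(1), of ?r r] u(1) assms(3) by simp
qed

text \<open>
  With distinct targets each player's move leaves the other's target intact, so the moves commute.
  With a common target the meeting point is the position without that pile.
\<close>

lemma confluent_psn:
  assumes "inj_on \<sigma> {1..n}"
  shows "confluent (psn n \<sigma> w)"
  unfolding confluent_def
proof (intro ballI)
  let ?l = "left_target n w" and ?r = "right_target n \<sigma> w"
  fix X Y assume "X |\<in>| left_opts (psn n \<sigma> w)" "Y |\<in>| right_opts (psn n \<sigma> w)"
  then obtain i j k where i: "i \<in> {1..n}" "0 < w i"
    and X: "j < w ?l" "X = psn n \<sigma> (w(?l := j))" and Y: "k < w ?r" "Y = psn n \<sigma> (w(?r := k))"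
    unfolding left_opts_psn right_opts_psn by blast
  note l = left_target[of i n w, OF i] and r = right_target[of i n w \<sigma>, OF i]
  have left: "left_target n (w(?r := k)) = ?l" if "?l = ?r \<Longrightarrow> 0 < k"
    by (rule left_target_unchanged[of ?l n w]) (use that l Y(1) in \<open>auto split: if_splits\<close>)
  have right: "right_target n \<sigma> (w(?l := j)) = ?r" if "?l = ?r \<Longrightarrow> 0 < j"
    by (rule right_target_unchanged[OF assms, of ?r w]) (use that r X(1) in \<open>auto split: if_splits\<close>)
  have pos: "\<exists>i\<in>{1..n}. 0 < (w(?l := j)) i" if "?l = ?r \<Longrightarrow> 0 < j"
    using that r by (intro bexI[of _ ?r]) auto
  have pos': "\<exists>i\<in>{1..n}. 0 < (w(?r := k)) i" if "?l = ?r \<Longrightarrow> 0 < k"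
    using that l by (intro bexI[of _ ?l]) auto
  show "\<exists>K. (K = X \<or> K |\<in>| right_opts X) \<and> (K = Y \<or> K |\<in>| left_opts Y)"
  proof (cases "?l = ?r")
    case True
    have "psn n \<sigma> (w(?l := 0)) |\<in>| right_opts X" if "0 < j"
      unfolding X right_opts_psn using that True right pos by auto
    moreover have "psn n \<sigma> (w(?l := 0)) |\<in>| left_opts Y" if "0 < k"
      unfolding Y left_opts_psn using that True left pos' by auto
    ultimately show ?thesis
      using X(2) Y(2) True by (intro exI[of _ "psn n \<sigma> (w(?l := 0))"]) (cases j; cases k; simp)
  next
    case False
    have "psn n \<sigma> (w(?l := j, ?r := k)) |\<in>| right_opts X"
      unfolding X(2) right_opts_psn using False right pos Y(1) by auto
    moreover have "psn n \<sigma> (w(?r := k, ?l := j)) |\<in>| left_opts Y"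
      unfolding Y(2) left_opts_psn using False left pos' X(1) by auto
    ultimately show ?thesis using False by (metis fun_upd_twist)
  qed
qed

theorem theorem5p4:
  fixes n :: nat and \<sigma> :: "nat \<Rightarrow> nat" and w :: "nat \<Rightarrow> nat"
  assumes "n \<ge> 1"
    and "\<sigma> permutes {1..n}"
    and "w \<in> positions n"
  shows "is_integer (aw (psn n \<sigma> w))"
proof (rule confluent_aw_integer[OF dicotic_psn])
  show "confluent H" if "H \<in> subpositions (psn n \<sigma> w)" for H
    using subpositions_psn[OF that] confluent_psn permutes_inj_on[OF assms(2)] by auto
qed

end
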